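(* Let $\xi$ be an all-small position with $\xi\neq 0$. Then $*+*\equiv 0\pmod{\mathrm{cl}(\xi)}$.
   Context: A position $\xi=\{\xi^L \mid \xi^R\}$ is given recursively by finite sets of Left and Right options; $0=\{\cdot\mid\cdot\}$, $*=\{0\mid 0\}$. A position is all-small if Left can move in it iff Right can, and every option is all-small. Disjunctive sum: $\alpha+\beta=\{\alpha^L+\beta,\alpha+\beta^L \mid \alpha^R+\beta,\alpha+\beta^R\}$. Under misère play a player unable to move on their turn wins; $o^-(\xi)\in\{\mathcal{L},\mathcal{R},\mathcal{N},\mathcal{P}\}$ is the misère outcome (Left wins always / Right wins always / next player wins / next player loses). $\mathrm{cl}(\Upsilon)$ is the smallest set containing $\Upsilon$ closed under disjunctive sum and taking options. For a closed set $\Gamma$ and $\alpha,\beta\in\Gamma$, $\alpha\equiv\beta\pmod\Gamma$ means $o^-(\alpha+\gamma)=o^-(\beta+\gamma)$ for all $\gamma\in\Gamma$. *)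

theory Defs
  imports Main "HOL-Library.FSet"
begin

datatype position = Pos (left_opts: "position fset") (right_opts: "position fset")

datatype player = Left | Right

primrec opponent :: "player \<Rightarrow> player" where
  "opponent Left = Right"
| "opponent Right = Left"

primrec opts :: "player \<Rightarrow> position \<Rightarrow> position fset" where
  "opts Left \<xi> = left_opts \<xi>"
| "opts Right \<xi> = right_opts \<xi>"

lemma size_left_opt: "\<eta> |\<in>| left_opts \<xi> \<Longrightarrow> size \<eta> < size \<xi>"
proof (cases \<xi>)
  case (Pos l r)
  assume "\<eta> |\<in>| left_opts \<xi>"
  then have "Suc (size \<eta>) \<le> (\<Sum>x\<in>fset l. Suc (size x))"
    using Pos member_le_sum[of \<eta> "fset l" "\<lambda>x. Suc (size x)"] by simp
  then show ?thesis using Pos by simp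
qed

lemma size_right_opt: "\<eta> |\<in>| right_opts \<xi> \<Longrightarrow> size \<eta> < size \<xi>"
proof (cases \<xi>)
  case (Pos l r)
  assume "\<eta> |\<in>| right_opts \<xi>"
  then have "Suc (size \<eta>) \<le> (\<Sum>x\<in>fset r. Suc (size x))"
    using Pos member_le_sum[of \<eta> "fset r" "\<lambda>x. Suc (size x)"] by simp
  then show ?thesis using Pos by simp
qed

lemma size_opt: "\<eta> |\<in>| opts p \<xi> \<Longrightarrow> size \<eta> < size \<xi>"
  by (cases p) (auto dest: size_left_opt size_right_opt)

definition zero_pos :: position where
  "zero_pos = Pos {||} {||}"

definition star :: position where
  "star = Pos {|zero_pos|} {|zero_pos|}"

function all_small :: "position \<Rightarrow> bool" where
  "all_small \<xi> \<longleftrightarrow>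
     (left_opts \<xi> \<noteq> {||} \<longleftrightarrow> right_opts \<xi> \<noteq> {||}) \<and>
     (\<forall>\<eta>|\<in>|left_opts \<xi>. all_small \<eta>) \<and>
     (\<forall>\<eta>|\<in>|right_opts \<xi>. all_small \<eta>)"
  by pat_completeness auto
termination
  by (relation "measure size") (auto dest: size_left_opt size_right_opt)

declare all_small.simps [simp del]

function disj_sum :: "position \<Rightarrow> position \<Rightarrow> position" (infixl "\<oplus>" 65) where
  "\<alpha> \<oplus> \<beta> = Pos
     ((\<lambda>\<alpha>'. \<alpha>' \<oplus> \<beta>) |`| left_opts \<alpha> |\<union>| (\<lambda>\<beta>'. \<alpha> \<oplus> \<beta>') |`| left_opts \<beta>)
     ((\<lambda>\<alpha>'. \<alpha>' \<oplus> \<beta>) |`| right_opts \<alpha> |\<union>| (\<lambda>\<beta>'. \<alpha> \<oplus> \<beta>') |`| right_opts \<beta>)"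
  by pat_completeness auto
termination
  by (relation "measure (\<lambda>(\<alpha>, \<beta>). size \<alpha> + size \<beta>)")
     (auto dest: size_left_opt size_right_opt)

declare disj_sum.simps [simp del]

text \<open>
  \<open>wins_first p \<xi>\<close>: player \<open>p\<close>, moving first in \<open>\<xi>\<close>, has a winning strategy under misere play.
  Play is finite and has no draws, so \<open>p\<close> wins moving second iff the opponent does not win
  moving first.
\<close>

function wins_first :: "player \<Rightarrow> position \<Rightarrow> bool" where
  "wins_first p \<xi> \<longleftrightarrow>
     opts p \<xi> = {||} \<or> (\<exists>\<eta>|\<in>|opts p \<xi>. \<not> wins_first (opponent p) \<eta>)"
  by pat_completeness auto
termination
  by (relation "measure (\<lambda>(p, \<xi>). size \<xi>)") (auto dest: size_opt)

declare wins_first.simps [simp del]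

datatype outcome = \<L> | \<R> | \<N> | \<P>

definition misere_outcome :: "position \<Rightarrow> outcome" where
  "misere_outcome \<xi> =
     (if wins_first Left \<xi>
      then (if wins_first Right \<xi> then \<N> else \<L>)
      else (if wins_first Right \<xi> then \<R> else \<P>))"

inductive_set cl :: "position set \<Rightarrow> position set" for \<Upsilon> :: "position set" where
  base: "\<xi> \<in> \<Upsilon> \<Longrightarrow> \<xi> \<in> cl \<Upsilon>"
| sum: "\<alpha> \<in> cl \<Upsilon> \<Longrightarrow> \<beta> \<in> cl \<Upsilon> \<Longrightarrow> \<alpha> \<oplus> \<beta> \<in> cl \<Upsilon>"
| left: "\<xi> \<in> cl \<Upsilon> \<Longrightarrow> \<eta> |\<in>| left_opts \<xi> \<Longrightarrow> \<eta> \<in> cl \<Upsilon>"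
| right: "\<xi> \<in> cl \<Upsilon> \<Longrightarrow> \<eta> |\<in>| right_opts \<xi> \<Longrightarrow> \<eta> \<in> cl \<Upsilon>"

text \<open>
  The relation is only meaningful between members of \<open>\<Gamma>\<close>, so membership of both sides is part of it.
\<close>

definition equiv_mod :: "position \<Rightarrow> position \<Rightarrow> position set \<Rightarrow> bool" where
  "equiv_mod \<alpha> \<beta> \<Gamma> \<longleftrightarrow>
     \<alpha> \<in> \<Gamma> \<and> \<beta> \<in> \<Gamma> \<and>
     (\<forall>\<gamma>\<in>\<Gamma>. misere_outcome (\<alpha> \<oplus> \<gamma>) = misere_outcome (\<beta> \<oplus> \<gamma>))"

end

theory Submission
  imports Defs
begin

text \<open>
  Adding \<open>* + *\<close> to an all-small \<open>\<gamma>\<close> does not change who wins: a player who wins \<open>\<gamma>\<close> plays as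
  before and answers a move in one \<open>*\<close> by a move in the other. The only position in which a player
  cannot move in \<open>\<gamma>\<close> is \<open>\<gamma> = 0\<close>, and \<open>* + *\<close> has the same outcome as \<open>0\<close>. Finally \<open>*\<close> belongs to
  \<open>cl(\<xi>)\<close> because a minimal nonzero subposition of \<open>\<xi>\<close> has \<open>0\<close> as its only option on both sides.
\<close>

lemma opts_zero_pos [simp]: "opts p zero_pos = {||}"
  by (cases p) (simp_all add: zero_pos_def)

lemma opts_star [simp]: "opts p star = {|zero_pos|}"
  by (cases p) (simp_all add: star_def)

lemma opts_disj_sum:
  "opts p (\<alpha> \<oplus> \<beta>) = (\<lambda>\<alpha>'. \<alpha>' \<oplus> \<beta>) |`| opts p \<alpha> |\<union>| (\<lambda>\<beta>'. \<alpha> \<oplus> \<beta>') |`| opts p \<beta>"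
  by (cases p) (subst disj_sum.simps, simp)+

lemma position_eqI:
  assumes "\<And>p. opts p \<alpha> = opts p \<beta>"
  shows "\<alpha> = \<beta>"
  using assms[of Left] assms[of Right] by (simp add: position.expand)

lemma disj_sum_zero_left [simp]: "zero_pos \<oplus> \<alpha> = \<alpha>"
proof (induction "size \<alpha>" arbitrary: \<alpha> rule: less_induct)
  case less
  show ?case
  proof (rule position_eqI)
    fix p
    \<comment> \<open>The right side is kept as an image under the identity, so that congruence
      leaves just the induction hypothesis on each option.\<close>
    have "(\<lambda>\<alpha>'. zero_pos \<oplus> \<alpha>') |`| opts p \<alpha> = (\<lambda>\<alpha>'. \<alpha>') |`| opts p \<alpha>"
      using less size_opt by (intro fset.map_cong refl) auto
    then show "opts p (zero_pos \<oplus> \<alpha>) = opts p \<alpha>"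
      by (simp add: opts_disj_sum)
  qed
qed

lemma disj_sum_zero_right [simp]: "\<alpha> \<oplus> zero_pos = \<alpha>"
proof (induction "size \<alpha>" arbitrary: \<alpha> rule: less_induct)
  case less
  show ?case
  proof (rule position_eqI)
    fix p
    have "(\<lambda>\<alpha>'. \<alpha>' \<oplus> zero_pos) |`| opts p \<alpha> = (\<lambda>\<alpha>'. \<alpha>') |`| opts p \<alpha>"
      using less size_opt by (intro fset.map_cong refl) auto
    then show "opts p (\<alpha> \<oplus> zero_pos) = opts p \<alpha>"
      by (simp add: opts_disj_sum)
  qed
qed

lemma all_small_opt: "all_small \<xi> \<Longrightarrow> \<eta> |\<in>| opts p \<xi> \<Longrightarrow> all_small \<eta>"
  by (cases p) (auto simp: all_small.simps[of \<xi>])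

text \<open>All-smallness makes either player stuck exactly when both are, and only
  \<open>zero_pos\<close> leaves both stuck.\<close>

lemma all_small_opts_empty_iff:
  assumes "all_small \<xi>"
  shows "opts p \<xi> = {||} \<longleftrightarrow> \<xi> = zero_pos"
proof -
  have "left_opts \<xi> = {||} \<longleftrightarrow> right_opts \<xi> = {||}"
    using assms by (auto simp: all_small.simps[of \<xi>])
  then show ?thesis
    by (cases p; cases \<xi>) (auto simp: zero_pos_def)
qed

lemma all_smallI:
  assumes "opts Left \<xi> = {||} \<longleftrightarrow> opts Right \<xi> = {||}"
    and "\<And>p \<eta>. \<eta> |\<in>| opts p \<xi> \<Longrightarrow> all_small \<eta>"
  shows "all_small \<xi>"
  using assms(1) assms(2)[of _ Left] assms(2)[of _ Right] by (auto simp: all_small.simps[of \<xi>])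

lemma all_small_disj_sum:
  assumes "all_small \<alpha>" and "all_small \<beta>"
  shows "all_small (\<alpha> \<oplus> \<beta>)"
  using assms
proof (induction "size \<alpha> + size \<beta>" arbitrary: \<alpha> \<beta> rule: less_induct)
  case less
  show ?case
  proof (rule all_smallI)
    show "opts Left (\<alpha> \<oplus> \<beta>) = {||} \<longleftrightarrow> opts Right (\<alpha> \<oplus> \<beta>) = {||}"
      using less.prems by (simp add: opts_disj_sum all_small_opts_empty_iff del: opts.simps)
  next
    fix p \<eta>
    assume "\<eta> |\<in>| opts p (\<alpha> \<oplus> \<beta>)"
    then consider \<alpha>' where "\<alpha>' |\<in>| opts p \<alpha>" "\<eta> = \<alpha>' \<oplus> \<beta>"
      | \<beta>' where "\<beta>' |\<in>| opts p \<beta>" "\<eta> = \<alpha> \<oplus> \<beta>'"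
      by (auto simp: opts_disj_sum)
    then show "all_small \<eta>"
      by cases (use less size_opt all_small_opt in force)+
  qed
qed

text \<open>Carries all-smallness from the generators to every test position of the closure.\<close>

lemma all_small_cl:
  assumes "\<gamma> \<in> cl \<Upsilon>" and "\<And>\<xi>. \<xi> \<in> \<Upsilon> \<Longrightarrow> all_small \<xi>"
  shows "all_small \<gamma>"
  using assms(1)
proof induction
  case (left \<xi> \<eta>)
  then show ?case using all_small_opt[of \<xi> \<eta> Left] by simp
next
  case (right \<xi> \<eta>)
  then show ?case using all_small_opt[of \<xi> \<eta> Right] by simp
qed (simp_all add: assms(2) all_small_disj_sum)

lemma cl_opt: "\<xi> \<in> cl \<Upsilon> \<Longrightarrow> \<eta> |\<in>| opts p \<xi> \<Longrightarrow> \<eta> \<in> cl \<Upsilon>"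
  by (cases p) (auto intro: cl.left cl.right)

lemma star_in_cl:
  assumes "\<xi> \<in> cl \<Upsilon>" and "all_small \<xi>" and "\<xi> \<noteq> zero_pos"
  shows "star \<in> cl \<Upsilon>"
  using assms
proof (induction "size \<xi>" arbitrary: \<xi> rule: less_induct)
  case less
  show ?case
  proof (cases "\<exists>p \<eta>. \<eta> |\<in>| opts p \<xi> \<and> \<eta> \<noteq> zero_pos")
    case True
    then show ?thesis
      using less size_opt cl_opt all_small_opt by blast
  next
    case False
    have "opts p \<xi> = {|zero_pos|}" for p
      \<comment> \<open>Every option is \<open>zero_pos\<close>, and a nonzero all-small position
        has an option for each player.\<close>
      using False all_small_opts_empty_iff[OF less.prems(2), of p] less.prems(3) by blast
    then have "\<xi> = star"
      by (intro position_eqI) simp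
    then show ?thesis using less.prems(1) by simp
  qed
qed

text \<open>Moving in either star leaves the same position, since \<open>zero_pos\<close> is neutral
  on both sides.\<close>

lemma opts_star_star_disj_sum:
  "opts p (star \<oplus> star \<oplus> \<gamma>) = finsert (star \<oplus> \<gamma>) ((\<lambda>\<gamma>'. star \<oplus> star \<oplus> \<gamma>') |`| opts p \<gamma>)"
  by (simp add: opts_disj_sum)

lemma opponent_opponent [simp]: "opponent (opponent p) = p"
  by (cases p) simp_all

lemma wins_first_zero_pos [simp]: "wins_first p zero_pos"
  by (simp add: wins_first.simps[of p zero_pos])

lemma not_wins_first_star [simp]: "\<not> wins_first p star"
  by (simp add: wins_first.simps[of p star])

text \<open>The outcome is determined by \<open>wins_first\<close> for the two players. The
  induction keeps \<open>p\<close> arbitrary because the hypothesis is needed for the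
  opponent.\<close>

lemma wins_first_star_star_disj_sum:
  assumes "all_small \<gamma>"
  shows "wins_first p (star \<oplus> star \<oplus> \<gamma>) \<longleftrightarrow> wins_first p \<gamma>"
  using assms
proof (induction "size \<gamma>" arbitrary: \<gamma> p rule: less_induct)
  case less
  let ?q = "opponent p"
  \<comment> \<open>The move to \<open>star \<oplus> \<gamma>\<close> always exists, so the clause
    for a stuck player drops out.\<close>
  have unfold: "wins_first p (star \<oplus> star \<oplus> \<gamma>) \<longleftrightarrow>
      \<not> wins_first ?q (star \<oplus> \<gamma>) \<or> (\<exists>\<gamma>'|\<in>|opts p \<gamma>. \<not> wins_first ?q (star \<oplus> star \<oplus> \<gamma>'))"
    by (subst wins_first.simps) (auto simp: opts_star_star_disj_sum)
  have IH: "wins_first ?q (star \<oplus> star \<oplus> \<gamma>') \<longleftrightarrow> wins_first ?q \<gamma>'" if "\<gamma>' |\<in>| opts p \<gamma>" for \<gamma>'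
    using less.hyps[OF size_opt[OF that] all_small_opt[OF less.prems that]] .
  show ?case
  proof (cases "\<gamma> = zero_pos")
    case True
    \<comment> \<open>Both sides are true: \<open>p\<close> is stuck at \<open>zero_pos\<close>, and
      moving to \<open>star\<close> wins because whoever moves from \<open>star\<close>
      loses.\<close>
    then show ?thesis using unfold by simp
  next
    case False
    \<comment> \<open>The opponent moves the remaining star to \<open>zero_pos\<close>, handing
      \<open>p\<close> the lost position \<open>\<gamma>\<close>.\<close>
    have reply: "wins_first ?q (star \<oplus> \<gamma>)" if "\<not> wins_first p \<gamma>"
      using that by (subst wins_first.simps) (simp add: opts_disj_sum)
    have "wins_first p \<gamma> \<longleftrightarrow> (\<exists>\<gamma>'|\<in>|opts p \<gamma>. \<not> wins_first ?q \<gamma>')"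
      using False all_small_opts_empty_iff[OF less.prems] by (subst wins_first.simps) simp
    then show ?thesis
      \<comment> \<open>If \<open>p\<close> wins \<open>\<gamma>\<close>, the same option wins by
        \<open>IH\<close>; otherwise \<open>reply\<close> refutes the star move and
        \<open>IH\<close> all others.\<close>
      using unfold reply IH by blast
  qed
qed

theorem theorem4p2p2:
  fixes \<xi> :: position
  assumes "all_small \<xi>"
    and "\<xi> \<noteq> zero_pos"
  shows "equiv_mod (star \<oplus> star) zero_pos (cl {\<xi>})"
proof -
  have star: "star \<in> cl {\<xi>}"
    using assms by (intro star_in_cl[of \<xi>] cl.base) simp_all
  moreover have "zero_pos \<in> cl {\<xi>}"
    \<comment> \<open>\<open>opts.simps\<close> would rewrite \<open>opts Left star\<close> to
      \<open>left_opts star\<close>, to which \<open>opts_star\<close> does not apply.\<close>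
    using star by (rule cl_opt[where p = Left]) (simp del: opts.simps)
  moreover have "all_small \<gamma>" if "\<gamma> \<in> cl {\<xi>}" for \<gamma>
    using that assms(1) by (auto intro: all_small_cl)
  ultimately show ?thesis
    by (simp add: equiv_mod_def cl.sum misere_outcome_def wins_first_star_star_disj_sum)
qed

end
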